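(* Let $X$ be a solid translation-invariant Banach space of functions $f:\mathbb R\to\mathbb C$ with absolutely continuous norm, and assume that the translation operator $T_1$ acts boundedly on $X$. Let $\lambda>\|T_1\|$ and $\mu>\lambda\|T_{-1}\|$, and define $T,S:X\to X$ by $$Tf=\lambda\,(T_{-1}f)\,\chi_{[0,\infty)},\qquad Sf=\lambda^{-1}T_1f,\qquad f\in X.$$ Assume that $\{f_k\}_{k=1}^\infty\subset X$ and $\mathrm{supp} f_k\subset[0,\infty)$ for all $k$. Also assume that for every $k\in\mathbb N$ there exist $a_k\in\mathbb N$ and $C_k>0$ such that for every $a\ge a_k$, $$\|f_k\chi_{[a,\infty)}\|\le C_k\mu^{-a}.$$ Fix a sequence $\{\epsilon_k\}_{k=1}^\infty\in\ell^1$ of positive scalars and choose an increasing sequence $\{\alpha(k)\}_{k=1}^\infty$ of nonnegative integers such that $$\|S\|^{\alpha(k)-\alpha(k-1)}\|f_k\|<\tfrac12\epsilon_k,\qquad k\ge2.$$ Then $\varphi:=\sum_{k=1}^\infty S^{\alpha(k)}f_k$ is well-defined (the series converges in $X$). Furthermore, if we also assume that $\alpha(1)=0$, $$\alpha(k+1)-\alpha(k)\ge a_k,\qquad k\in\mathbb N,$$ and, for all $k\ge2$, $$\alpha(k)\ge\frac{\ln(2)+\ln\Big(\sum_{n=1}^{k-1}C_n\big((\lambda\|T_{-1}\|)^{-1}\mu\big)^{\alpha(n)}\Big)-\ln\Big(\sum_{j=k+1}^\infty\epsilon_j\Big)}{\ln\big((\lambda\|T_{-1}\|)^{-1}\mu\big)},$$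 then for all $k\in\mathbb N$, $$\|f_k-T^{\alpha(k)}\varphi\|\le\sum_{n=k+1}^\infty\epsilon_n.$$
   Context: For $a\in\mathbb R$, the translation operator $T_a$ acts on functions $f:\mathbb R\to\mathbb C$ by $T_af(x):=f(x-a)$. The space $X$ is translation invariant if $T_1$ and $T_{-1}$ map functions in $X$ into $X$; in this case, if $T_1$ is bounded on $X$, then $T_{-1}$ is bounded as well. (The operators $T_1,T_{-1}$ are translations and are not to be confused with the operator $T$.) Functions are (measurable) functions on $\mathbb R$, identified when equal almost everywhere. $X$ is solid if whenever $f\in X$ and $g:\mathbb R\to\mathbb C$ is a (measurable) function with $|g(x)|\le|f(x)|$ for (almost) all $x\in\mathbb R$, then $g\in X$ and $\|g\|\le\|f\|$. $X$ has an absolutely continuous norm if $\|f-f\chi_{I_n}\|\to0$ as $n\to\infty$ for every $f\in X$ and every family of (measurable) subsets $I_n\subset\mathbb R$ with $I_1\subset I_2\subset\cdots$ and $\bigcup_nI_n=\mathbb R$. $\chi_I$ denotes the characteristic function of $I$. Standing assumption: $X$ is separable. *)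

theory Defs
  imports "HOL-Analysis.Analysis"
begin

text \<open>
  A Banach space of (Lebesgue) measurable functions on the real line, identified when equal almost
  everywhere, is represented by the set \<open>X\<close> of all representatives of its elements together
  with the norm \<open>nrm\<close> read on representatives.  Hence \<open>X\<close> is closed under almost everywhere
  equality, \<open>nrm\<close> does not depend on the representative, and \<open>nrm f = 0\<close> means that \<open>f\<close>
  vanishes almost everywhere.  The values of \<open>nrm\<close> outside \<open>X\<close> play no role.
\<close>

locale banach_function_space =
  fixes X :: "(real \<Rightarrow> complex) set" and nrm :: "(real \<Rightarrow> complex) \<Rightarrow> real"
  assumes measurable: "f \<in> X \<Longrightarrow> f \<in> borel_measurable lebesgue"
    and zero_closed: "(\<lambda>x. 0) \<in> X"
    and add_closed: "f \<in> X \<Longrightarrow> g \<in> X \<Longrightarrow> (\<lambda>x. f x + g x) \<in> X"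
    and scale_closed: "f \<in> X \<Longrightarrow> (\<lambda>x. c * f x) \<in> X"
    and ae_closed: "f \<in> X \<Longrightarrow> g \<in> borel_measurable lebesgue \<Longrightarrow>
      (AE x in lebesgue. g x = f x) \<Longrightarrow> g \<in> X"
    and nrm_ae_cong: "f \<in> X \<Longrightarrow> g \<in> X \<Longrightarrow> (AE x in lebesgue. g x = f x) \<Longrightarrow> nrm g = nrm f"
    and nrm_nonneg: "f \<in> X \<Longrightarrow> 0 \<le> nrm f"
    and nrm_eq_0_iff: "f \<in> X \<Longrightarrow> nrm f = 0 \<longleftrightarrow> (AE x in lebesgue. f x = 0)"
    and nrm_triangle: "f \<in> X \<Longrightarrow> g \<in> X \<Longrightarrow> nrm (\<lambda>x. f x + g x) \<le> nrm f + nrm g"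
    and nrm_scale: "f \<in> X \<Longrightarrow> nrm (\<lambda>x. c * f x) = cmod c * nrm f"
    and complete: "(\<And>n. u n \<in> X) \<Longrightarrow>
      (\<forall>e>0. \<exists>M. \<forall>m\<ge>M. \<forall>n\<ge>M. nrm (\<lambda>x. u m x - u n x) < e) \<Longrightarrow>
      \<exists>g\<in>X. (\<lambda>n. nrm (\<lambda>x. u n x - g x)) \<longlonglongrightarrow> 0"

definition separable_fs ::
  "(real \<Rightarrow> complex) set \<Rightarrow> ((real \<Rightarrow> complex) \<Rightarrow> real) \<Rightarrow> bool" where
  "separable_fs X nrm \<longleftrightarrow>
    (\<exists>D\<subseteq>X. countable D \<and> (\<forall>f\<in>X. \<forall>e>0. \<exists>d\<in>D. nrm (\<lambda>x. f x - d x) < e))"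

definition solid_fs ::
  "(real \<Rightarrow> complex) set \<Rightarrow> ((real \<Rightarrow> complex) \<Rightarrow> real) \<Rightarrow> bool" where
  "solid_fs X nrm \<longleftrightarrow>
    (\<forall>f\<in>X. \<forall>g\<in>borel_measurable lebesgue.
      (AE x in lebesgue. cmod (g x) \<le> cmod (f x)) \<longrightarrow> g \<in> X \<and> nrm g \<le> nrm f)"

definition absolutely_continuous_nrm ::
  "(real \<Rightarrow> complex) set \<Rightarrow> ((real \<Rightarrow> complex) \<Rightarrow> real) \<Rightarrow> bool" where
  "absolutely_continuous_nrm X nrm \<longleftrightarrow>
    (\<forall>f\<in>X. \<forall>I::nat \<Rightarrow> real set.
      (\<forall>n. I n \<in> sets lebesgue) \<longrightarrow> incseq I \<longrightarrow> (\<Union>n. I n) = UNIV \<longrightarrow>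
      (\<lambda>n. nrm (\<lambda>x. f x - f x * indicator (I n) x)) \<longlonglongrightarrow> 0)"

definition translation :: "real \<Rightarrow> (real \<Rightarrow> complex) \<Rightarrow> real \<Rightarrow> complex" where
  "translation a f = (\<lambda>x. f (x - a))"

definition translation_invariant :: "(real \<Rightarrow> complex) set \<Rightarrow> bool" where
  "translation_invariant X \<longleftrightarrow> translation 1 ` X \<subseteq> X \<and> translation (-1) ` X \<subseteq> X"

definition bounded_op ::
  "(real \<Rightarrow> complex) set \<Rightarrow> ((real \<Rightarrow> complex) \<Rightarrow> real) \<Rightarrow>
   ((real \<Rightarrow> complex) \<Rightarrow> real \<Rightarrow> complex) \<Rightarrow> bool" where
  "bounded_op X nrm A \<longleftrightarrow> (\<exists>K. \<forall>f\<in>X. nrm (A f) \<le> K * nrm f)"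

text \<open>The supremum is only meaningful when \<open>bounded_op X nrm A\<close>.\<close>

definition op_norm ::
  "(real \<Rightarrow> complex) set \<Rightarrow> ((real \<Rightarrow> complex) \<Rightarrow> real) \<Rightarrow>
   ((real \<Rightarrow> complex) \<Rightarrow> real \<Rightarrow> complex) \<Rightarrow> real" where
  "op_norm X nrm A = (SUP f\<in>{f\<in>X. nrm f \<le> 1}. nrm (A f))"

text \<open>The support of an almost everywhere class: the complement of the largest open set on
  which the function vanishes almost everywhere.\<close>

definition ess_supp :: "(real \<Rightarrow> complex) \<Rightarrow> real set" where
  "ess_supp f = - \<Union>{U. open U \<and> (AE x in lebesgue. x \<in> U \<longrightarrow> f x = 0)}"

text \<open>The series with terms \<open>u 1, u 2, \<dots>\<close> converges to \<open>g\<close> in the norm of \<open>X\<close>.\<close>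

definition sums_in ::
  "(real \<Rightarrow> complex) set \<Rightarrow> ((real \<Rightarrow> complex) \<Rightarrow> real) \<Rightarrow>
   (nat \<Rightarrow> real \<Rightarrow> complex) \<Rightarrow> (real \<Rightarrow> complex) \<Rightarrow> bool" where
  "sums_in X nrm u g \<longleftrightarrow>
    g \<in> X \<and> (\<lambda>n. nrm (\<lambda>x. (\<Sum>k=1..n. u k x) - g x)) \<longlonglongrightarrow> 0"

end

theory Submission imports Defs begin

text \<open>
  Since \<open>T\<close> undoes \<open>S\<close> on functions living on the half-line, \<open>T ^^ \<alpha> k\<close> turns the \<open>j\<close>-th term of
  the series into \<open>(S ^^ (\<alpha> j - \<alpha> k)) (f j)\<close> for \<open>j > k\<close>, into \<open>f k\<close> for \<open>j = k\<close>, and for \<open>j < k\<close>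
  into a translate by \<open>d = \<alpha> k - \<alpha> j\<close> of the part of \<open>f j\<close> on \<open>[d, \<infinity>)\<close>, scaled by \<open>lam ^ d\<close>.
  The terms with \<open>j > k\<close> have norm at most \<open>\<epsilon> j / 2\<close>; those with \<open>j < k\<close> decay like
  \<open>(\<mu> / (lam * M)) ^ - d\<close>, where \<open>M\<close> is the norm of the translation by \<open>-1\<close>, and the lower bound on
  \<open>\<alpha> k\<close> makes their sum at most half of the tail of \<open>\<epsilon>\<close>.
\<close>

section \<open>Null sets under shifts and essential supports\<close>

lemma AE_lebesgue_shift:
  fixes c :: real
  assumes "AE x in lebesgue. P x"
  shows "AE x in lebesgue. P (x + c)"
proof -
  have "negligible {x. \<not> P x}"
    using assms by (auto simp: eventually_ae_filter_negligible intro: negligible_subset)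
  then have "negligible ((+) (- c) ` {x. \<not> P x})"
    by (rule negligible_translation)
  moreover have "{x. \<not> P (x + c)} \<subseteq> (+) (- c) ` {x. \<not> P x}"
    by (auto simp: image_iff intro!: exI[where x = "_ + c"])
  ultimately show ?thesis
    by (auto simp: eventually_ae_filter_negligible)
qed

text \<open>The open sets in \<open>ess_supp\<close> may form an uncountable family, each with its
  own null set of exceptions. By Lindelof a countable subfamily has the same union, so the
  exceptions still form a null set.\<close>

lemma ess_supp_AE_zero:
  "AE x in lebesgue. x \<notin> ess_supp g \<longrightarrow> g x = 0"
proof -
  let ?\<U> = "{U. open U \<and> (AE x in lebesgue. x \<in> U \<longrightarrow> g x = 0)}"
  obtain \<V> where \<V>: "\<V> \<subseteq> ?\<U>" "countable \<V>" "\<Union>\<V> = \<Union>?\<U>"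
    by (rule Lindelof[of ?\<U>]) auto
  have "AE x in lebesgue. \<forall>U\<in>\<V>. x \<in> U \<longrightarrow> g x = 0"
    using \<V>(1,2) by (subst AE_ball_countable) auto
  then show ?thesis
  proof (rule AE_mp, intro AE_I2 impI)
    fix x assume "\<forall>U\<in>\<V>. x \<in> U \<longrightarrow> g x = 0" "x \<notin> ess_supp g"
    then show "g x = 0"
      using \<V>(3) by (auto simp: ess_supp_def)
  qed
qed

lemma solid_fsD:
  assumes "solid_fs X nrm" "f \<in> X" "g \<in> borel_measurable lebesgue"
    and "AE x in lebesgue. cmod (g x) \<le> cmod (f x)"
  shows "g \<in> X \<and> nrm g \<le> nrm f"
  using assms by (auto simp: solid_fs_def)

section \<open>Norms and series in \<open>X\<close>, and automatic boundedness\<close>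

context banach_function_space
begin

lemma nrm_zero: "nrm (\<lambda>x. 0) = 0"
  using nrm_eq_0_iff[OF zero_closed] by simp

lemma uminus_closed: "f \<in> X \<Longrightarrow> (\<lambda>x. - f x) \<in> X"
  using scale_closed[of f "-1"] by simp

lemma nrm_uminus: "f \<in> X \<Longrightarrow> nrm (\<lambda>x. - f x) = nrm f"
  using nrm_scale[of f "-1"] by simp

lemma diff_closed: "f \<in> X \<Longrightarrow> g \<in> X \<Longrightarrow> (\<lambda>x. f x - g x) \<in> X"
  using add_closed[of f "\<lambda>x. - g x"] uminus_closed[of g] by simp

lemma nrm_diff_commute: "f \<in> X \<Longrightarrow> g \<in> X \<Longrightarrow> nrm (\<lambda>x. f x - g x) = nrm (\<lambda>x. g x - f x)"
  using nrm_uminus[OF diff_closed, of f g] by simp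

lemma nrm_triangle_diff: "f \<in> X \<Longrightarrow> g \<in> X \<Longrightarrow> nrm (\<lambda>x. f x - g x) \<le> nrm f + nrm g"
  using nrm_triangle[of f "\<lambda>x. - g x"] uminus_closed[of g] nrm_uminus[of g] by simp

lemma sum_closed_nrm_sum:
  assumes "finite F" "\<And>k. k \<in> F \<Longrightarrow> u k \<in> X"
  shows "(\<lambda>x. \<Sum>k\<in>F. u k x) \<in> X \<and> nrm (\<lambda>x. \<Sum>k\<in>F. u k x) \<le> (\<Sum>k\<in>F. nrm (u k))"
  using assms
proof (induction F)
  case empty
  then show ?case by (simp add: zero_closed nrm_zero)
next
  case (insert a F)
  then have IH: "(\<lambda>x. \<Sum>k\<in>F. u k x) \<in> X" "nrm (\<lambda>x. \<Sum>k\<in>F. u k x) \<le> (\<Sum>k\<in>F. nrm (u k))"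
    and u: "u a \<in> X" by auto
  from nrm_triangle[OF u IH(1)] add_closed[OF u IH(1)] IH(2) insert.hyps show ?case
    by simp
qed

lemmas sum_closed = sum_closed_nrm_sum[THEN conjunct1]
lemmas nrm_sum = sum_closed_nrm_sum[THEN conjunct2]

text \<open>The Cauchy criterion sees only tails, so the bound is asked from \<open>N\<close> on.
  This fits the size condition of the theorem, which starts at the second term.\<close>

lemma sums_in_comparison:
  assumes u: "\<And>k. k \<ge> 1 \<Longrightarrow> u k \<in> X"
    and b: "summable b" and le: "\<And>k. k \<ge> N \<Longrightarrow> nrm (u k) \<le> b k"
  shows "\<exists>g. sums_in X nrm u g"
proof -
  define s where "s = (\<lambda>n x. \<Sum>k=1..n. u k x)"
  have s: "s n \<in> X" for n
    unfolding s_def using u by (intro sum_closed) auto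
  \<comment> \<open>The half-open interval under \<open>norm\<close> is the form in which
    \<open>summable_Cauchy\<close> supplies smallness.\<close>
  have tail: "nrm (\<lambda>x. s n x - s m x) \<le> norm (sum b {Suc m..<Suc n})" if "N \<le> m" "m \<le> n" for m n
  proof -
    have "{1..n} = {1..m} \<union> {Suc m..n}" using that by auto
    then have "s n x - s m x = (\<Sum>k=Suc m..n. u k x)" for x
      by (simp add: s_def sum.union_disjoint)
    then have "nrm (\<lambda>x. s n x - s m x) \<le> (\<Sum>k=Suc m..n. nrm (u k))"
      using nrm_sum[of "{Suc m..n}" u] u by simp
    also have "\<dots> \<le> (\<Sum>k=Suc m..n. b k)"
      using that le by (intro sum_mono) auto
    also have "\<dots> \<le> norm (sum b {Suc m..<Suc n})"
      by (simp add: atLeastLessThanSuc_atLeastAtMost)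
    finally show ?thesis .
  qed
  have "\<exists>M. \<forall>m\<ge>M. \<forall>n\<ge>M. nrm (\<lambda>x. s m x - s n x) < e" if "e > 0" for e
  proof -
    obtain K where K: "\<And>m n. m \<ge> K \<Longrightarrow> norm (sum b {m..<n}) < e"
      using b \<open>e > 0\<close> unfolding summable_Cauchy by meson
    have "nrm (\<lambda>x. s m x - s n x) < e" if "m \<ge> max K N" "n \<ge> max K N" for m n
    proof (cases "m \<le> n")
      case True
      then show ?thesis
        using tail[of m n] K[of "Suc m" "Suc n"] nrm_diff_commute[OF s s, of m n] that by force
    next
      case False
      then show ?thesis using tail[of n m] K[of "Suc n" "Suc m"] that by force
    qed
    then show ?thesis by blast
  qed
  then obtain g where "g \<in> X" "(\<lambda>n. nrm (\<lambda>x. s n x - g x)) \<longlonglongrightarrow> 0"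
    using complete[of s] s by blast
  then show ?thesis by (auto simp: sums_in_def s_def)
qed

text \<open>If \<open>A\<close> were unbounded, witnesses \<open>F n\<close> with \<open>nrm (A (F n)) > 4 ^ n * nrm (F n)\<close> could be
  glued: the sum \<open>g\<close> of \<open>2 ^ - n * \<bar>F n\<bar> / nrm (F n)\<close> dominates each term, so
  \<open>nrm (A g) \<ge> 2 ^ n\<close> for all \<open>n\<close>.\<close>

lemma positive_bounded_op:
  assumes solid: "solid_fs X nrm"
    and A: "\<And>f. f \<in> X \<Longrightarrow> A f \<in> X"
    and A_scale: "\<And>c f. f \<in> X \<Longrightarrow> A (\<lambda>x. c * f x) = (\<lambda>x. c * A f x)"
    and A_mono: "\<And>f g. f \<in> X \<Longrightarrow> g \<in> X \<Longrightarrow> (AE x in lebesgue. cmod (f x) \<le> cmod (g x)) \<Longrightarrow>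
      nrm (A f) \<le> nrm (A g)"
  shows "bounded_op X nrm A"
proof (rule ccontr)
  assume "\<not> bounded_op X nrm A"
  then have "\<forall>n::nat. \<exists>f\<in>X. nrm (A f) > 4 ^ n * nrm f"
    unfolding bounded_op_def by (meson not_le)
  then obtain F where F: "\<And>n. F n \<in> X" and unb: "\<And>n. nrm (A (F n)) > 4 ^ n * nrm (F n)"
    by metis
  \<comment> \<open>A witness of norm 0 would be dominated almost everywhere by the zero function,
    whose image has norm 0; this contradicts the strict inequality \<open>unb\<close>.\<close>
  have pos: "nrm (F n) > 0" for n
  proof (rule ccontr)
    assume "\<not> nrm (F n) > 0"
    then have "nrm (F n) = 0" using nrm_nonneg[OF F, of n] by linarith
    moreover from this have "AE x in lebesgue. cmod (F n x) \<le> cmod 0"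
      using nrm_eq_0_iff[OF F] by simp
    then have "nrm (A (F n)) \<le> nrm (A (\<lambda>x. 0))"
      by (intro A_mono[OF F zero_closed])
    moreover have "nrm (A (\<lambda>x. 0)) = 0"
      using A_scale[OF zero_closed, of 0] nrm_zero by simp
    ultimately show False using unb[of n] by simp
  qed
  \<comment> \<open>With this factor \<open>c n * F n\<close> has norm \<open>2 ^ - n\<close>, while
    its image under \<open>A\<close> has norm above \<open>2 ^ n\<close>.\<close>
  define c where "c n = 1 / (2 ^ n * nrm (F n))" for n
  have c: "c n > 0" for n using pos[of n] by (simp add: c_def)
  define u :: "nat \<Rightarrow> real \<Rightarrow> complex" where "u n = (\<lambda>x. of_real (c n * cmod (F n x)))" for n
  have u: "u n \<in> X" "nrm (u n) \<le> (1 / 2) ^ n" for n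
  proof -
    have meas: "u n \<in> borel_measurable lebesgue"
      using measurable[OF F, of n] unfolding u_def by measurable
    have cF: "(\<lambda>x. of_real (c n) * F n x) \<in> X" "nrm (\<lambda>x. of_real (c n) * F n x) = (1 / 2) ^ n"
      unfolding nrm_scale[OF F] using pos[of n]
      by (auto simp only: scale_closed[OF F])
        (simp add: c_def norm_divide norm_mult norm_power power_divide)
    have "AE x in lebesgue. cmod (u n x) \<le> cmod (of_real (c n) * F n x)"
      using c[of n] by (simp add: u_def norm_mult)
    then show "u n \<in> X" "nrm (u n) \<le> (1 / 2) ^ n"
      using solid cF meas unfolding solid_fs_def by auto
  qed
  obtain g where g: "g \<in> X" and lim: "(\<lambda>n. nrm (\<lambda>x. (\<Sum>k=1..n. u k x) - g x)) \<longlonglongrightarrow> 0"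
    using sums_in_comparison[of u "\<lambda>n. (1 / 2) ^ n" 0] u
    by (auto simp: sums_in_def)
  \<comment> \<open>As \<open>g\<close> is only a norm limit, pointwise domination needs an
    argument: the excess \<open>v\<close> of \<open>u N\<close> over \<open>\<bar>g\<bar>\<close> is
    at most the distance of every later partial sum to \<open>g\<close>, so solidity forces
    \<open>nrm v = 0\<close>.\<close>
  have dom: "AE x in lebesgue. cmod (u N x) \<le> cmod (g x)" if "N \<ge> 1" for N
  proof -
    define v :: "real \<Rightarrow> complex" where
      "v = (\<lambda>x. of_real (max 0 (cmod (u N x) - cmod (g x))))"
    have v_meas: "v \<in> borel_measurable lebesgue"
      using measurable[OF g] measurable[OF u(1), of N] unfolding v_def by measurable
    have v_le: "v \<in> X \<and> nrm v \<le> nrm (\<lambda>x. (\<Sum>k=1..n. u k x) - g x)" if "n \<ge> N" for n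
    proof -
      have "cmod (v x) \<le> cmod ((\<Sum>k=1..n. u k x) - g x)" for x
      proof -
        have "cmod (u N x) = c N * cmod (F N x)"
          using c[of N] by (simp add: u_def norm_mult)
        also have "\<dots> \<le> (\<Sum>k=1..n. c k * cmod (F k x))"
          using c \<open>N \<ge> 1\<close> \<open>n \<ge> N\<close>
          by (intro member_le_sum mult_nonneg_nonneg) (auto intro: less_imp_le)
        also have "\<dots> \<le> cmod (of_real (\<Sum>k=1..n. c k * cmod (F k x)))"
          by (simp only: norm_of_real abs_ge_self)
        also have "\<dots> = cmod (\<Sum>k=1..n. u k x)"
          by (simp add: u_def)
        finally show ?thesis
          using norm_triangle_ineq2[of "\<Sum>k=1..n. u k x" "g x"] by (auto simp: v_def)
      qed
      moreover have "(\<lambda>x. (\<Sum>k=1..n. u k x) - g x) \<in> X"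
        using u g by (intro diff_closed sum_closed) auto
      ultimately show ?thesis
        using solid v_meas unfolding solid_fs_def by auto
    qed
    then have "v \<in> X" by blast
    have "nrm v \<le> 0"
      using v_le by (intro LIMSEQ_le_const[OF lim]) blast
    then have "AE x in lebesgue. v x = 0"
      using nrm_nonneg[OF \<open>v \<in> X\<close>] nrm_eq_0_iff[OF \<open>v \<in> X\<close>] by force
    then show ?thesis
      by (rule AE_mp, intro AE_I2) (auto simp: v_def max_def split: if_splits)
  qed
  have grow: "2 ^ N < nrm (A g)" if "N \<ge> 1" for N
  proof -
    have "AE x in lebesgue. cmod (of_real (c N) * F N x) \<le> cmod (g x)"
      using dom[OF that] c[of N] by (simp add: u_def norm_mult)
    then have "nrm (A (\<lambda>x. of_real (c N) * F N x)) \<le> nrm (A g)"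
      by (intro A_mono scale_closed F g)
    moreover have "nrm (A (\<lambda>x. of_real (c N) * F N x)) = c N * nrm (A (F N))"
      using c[of N] by (simp add: A_scale F nrm_scale A)
    moreover have "c N * nrm (A (F N)) > c N * (4 ^ N * nrm (F N))"
      using unb c by simp
    moreover have "c N * (4 ^ N * nrm (F N)) = 2 ^ N"
      using pos[of N] by (simp add: c_def field_simps flip: power_mult_distrib)
    ultimately show ?thesis by simp
  qed
  \<comment> \<open>This \<open>N\<close> may be 0, where \<open>grow\<close> says nothing; hence
    the passage to \<open>Suc N\<close>.\<close>
  obtain N where "nrm (A g) < 2 ^ N"
    using real_arch_pow[of 2 "nrm (A g)"] by auto
  then have "nrm (A g) < 2 ^ Suc N"
    by (rule less_le_trans) simp
  then show False using grow[of "Suc N"] by simp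
qed

section \<open>Operator norms, powers of operators and boundedness of translations\<close>

lemma bounded_op_bdd_above:
  assumes "bounded_op X nrm A"
  shows "bdd_above ((\<lambda>f. nrm (A f)) ` {f \<in> X. nrm f \<le> 1})"
proof -
  obtain K where K: "\<And>f. f \<in> X \<Longrightarrow> nrm (A f) \<le> K * nrm f"
    using assms by (auto simp: bounded_op_def)
  have "nrm (A f) \<le> \<bar>K\<bar>" if "f \<in> X" "nrm f \<le> 1" for f
  proof -
    have "K * nrm f \<le> \<bar>K\<bar> * 1"
      using that nrm_nonneg by (intro mult_mono) auto
    then show ?thesis using K[OF that(1)] by simp
  qed
  then show ?thesis by (intro bdd_aboveI[where M = "\<bar>K\<bar>"]) auto
qed

lemma op_norm_nonneg:
  assumes "bounded_op X nrm A" "A (\<lambda>x. 0) \<in> X"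
  shows "0 \<le> op_norm X nrm A"
proof -
  have "nrm (A (\<lambda>x. 0)) \<le> op_norm X nrm A"
    unfolding op_norm_def
    by (intro cSUP_upper bounded_op_bdd_above assms) (simp add: zero_closed nrm_zero)
  then show ?thesis using nrm_nonneg[OF assms(2)] by linarith
qed

text \<open>Homogeneity reduces to norm 1, where the supremum applies. An \<open>f\<close> of norm 0
  cannot be normalized, but any bound from \<open>bounded_op\<close> then gives
  \<open>nrm (A f) \<le> 0\<close>.\<close>

lemma nrm_le_op_norm:
  assumes bd: "bounded_op X nrm A" and A: "\<And>f. f \<in> X \<Longrightarrow> A f \<in> X"
    and A_scale: "\<And>c f. f \<in> X \<Longrightarrow> A (\<lambda>x. c * f x) = (\<lambda>x. c * A f x)"
    and f: "f \<in> X"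
  shows "nrm (A f) \<le> op_norm X nrm A * nrm f"
proof (cases "nrm f = 0")
  case True
  then show ?thesis using bd f unfolding bounded_op_def by fastforce
next
  case False
  then have pos: "nrm f > 0" using nrm_nonneg[OF f] by simp
  let ?g = "\<lambda>x. of_real (inverse (nrm f)) * f x"
  have "?g \<in> X" "nrm ?g = 1"
    using pos by (auto simp add: scale_closed[OF f] nrm_scale[OF f] simp del: of_real_inverse)
  then have "nrm (A ?g) \<le> op_norm X nrm A"
    unfolding op_norm_def by (intro cSUP_upper bounded_op_bdd_above bd) simp
  moreover have "nrm (A ?g) = nrm (A f) / nrm f"
    unfolding A_scale[OF f] nrm_scale[OF A[OF f]] using pos by (simp add: divide_inverse_commute norm_inverse)
  ultimately have "nrm (A f) / nrm f \<le> op_norm X nrm A" by (simp only:)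
  then show ?thesis using pos by (simp add: field_simps)
qed

lemma funpow_bound:
  assumes A: "\<And>f. f \<in> X \<Longrightarrow> A f \<in> X" and le: "\<And>f. f \<in> X \<Longrightarrow> nrm (A f) \<le> K * nrm f"
    and "K \<ge> 0" and f: "f \<in> X"
  shows "(A ^^ n) f \<in> X \<and> nrm ((A ^^ n) f) \<le> K ^ n * nrm f"
proof (induction n)
  case 0
  then show ?case by (simp add: f)
next
  case (Suc n)
  then have "nrm ((A ^^ Suc n) f) \<le> K * nrm ((A ^^ n) f)" using le by simp
  also have "\<dots> \<le> K * (K ^ n * nrm f)" using Suc \<open>K \<ge> 0\<close> by (intro mult_left_mono) auto
  finally show ?case using Suc A by (simp add: mult.assoc)
qed

text \<open>Makes the operator norm of the inverse translation a genuine bound. Shifting preserves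
  domination of moduli almost everywhere, so positivity yields boundedness.\<close>

lemma translation_bounded:
  assumes "solid_fs X nrm" "translation a ` X \<subseteq> X"
  shows "bounded_op X nrm (translation a)"
proof (rule positive_bounded_op[OF assms(1)])
  fix f g assume fg: "f \<in> X" "g \<in> X" "AE x in lebesgue. cmod (f x) \<le> cmod (g x)"
  have "AE x in lebesgue. cmod (f (x + - a)) \<le> cmod (g (x + - a))"
    by (rule AE_lebesgue_shift) (rule fg)
  then have "AE x in lebesgue. cmod (translation a f x) \<le> cmod (translation a g x)"
    by (simp add: translation_def)
  moreover have "translation a f \<in> X" "translation a g \<in> X" using fg assms(2) by auto
  ultimately show "nrm (translation a f) \<le> nrm (translation a g)"
    using assms(1) measurable unfolding solid_fs_def by blast
qed (use assms(2) in \<open>auto simp: translation_def\<close>)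

end

section \<open>Closed formulas for powers of scaled and truncated translations\<close>

lemma scaled_translation_pow:
  "((\<lambda>g x. c * translation a g x) ^^ n) g x = c ^ n * g (x - real n * a)"
  by (induction n arbitrary: x) (simp_all add: translation_def algebra_simps)

text \<open>The intermediate cutoffs test \<open>x + i \<ge> 0\<close> with \<open>i > 0\<close>,
  which the last one, \<open>x \<ge> 0\<close>, implies; so a single cutoff survives. The power 0
  has none.\<close>

lemma truncated_translation_pow:
  "((\<lambda>g x. c * translation (- 1) g x * indicator {0..} x) ^^ n) g x =
    c ^ n * g (x + real n) * (if n = 0 then 1 else indicator {0..} x)"
  by (induction n arbitrary: x) (auto simp: translation_def algebra_simps indicator_def)

theorem theorem2p4:
  fixes X :: "(real \<Rightarrow> complex) set" and nrm :: "(real \<Rightarrow> complex) \<Rightarrow> real"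
    and lam \<mu> :: real
    and T S :: "(real \<Rightarrow> complex) \<Rightarrow> real \<Rightarrow> complex"
    and f :: "nat \<Rightarrow> real \<Rightarrow> complex"
    and a :: "nat \<Rightarrow> nat" and C :: "nat \<Rightarrow> real"
    and \<epsilon> :: "nat \<Rightarrow> real" and \<alpha> :: "nat \<Rightarrow> nat"
  assumes "banach_function_space X nrm"
    and "separable_fs X nrm"
    and "solid_fs X nrm"
    and "translation_invariant X"
    and "absolutely_continuous_nrm X nrm"
    and "bounded_op X nrm (translation 1)"
    and "lam > op_norm X nrm (translation 1)"
    and "\<mu> > lam * op_norm X nrm (translation (-1))"
    and "T = (\<lambda>g x. of_real lam * translation (-1) g x * indicator {0..} x)"
    and "S = (\<lambda>g x. of_real (inverse lam) * translation 1 g x)"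
    and "\<forall>k\<ge>1. f k \<in> X \<and> ess_supp (f k) \<subseteq> {0..}"
    and "\<forall>k\<ge>1. C k > 0"
    and "\<forall>k\<ge>1. \<forall>b::nat. b \<ge> a k \<longrightarrow>
           nrm (\<lambda>x. f k x * indicator {real b..} x) \<le> C k * \<mu> powr (- real b)"
    and "\<forall>k\<ge>1. \<epsilon> k > 0"
    and "\<epsilon> summable_on {1..}"
    and "mono_on {1..} \<alpha>"
    and "\<forall>k\<ge>2. op_norm X nrm S ^ (\<alpha> k - \<alpha> (k - 1)) * nrm (f k) < 1 / 2 * \<epsilon> k"
  shows "(\<exists>\<phi>. sums_in X nrm (\<lambda>k. (S ^^ \<alpha> k) (f k)) \<phi>) \<and>
    (\<forall>\<phi>. sums_in X nrm (\<lambda>k. (S ^^ \<alpha> k) (f k)) \<phi> \<longrightarrow>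
      \<alpha> 1 = 0 \<longrightarrow>
      (\<forall>k\<ge>1. \<alpha> (k + 1) - \<alpha> k \<ge> a k) \<longrightarrow>
      (\<forall>k\<ge>2. real (\<alpha> k) \<ge>
         (ln 2
          + ln (\<Sum>n=1..k-1. C n * (inverse (lam * op_norm X nrm (translation (-1))) * \<mu>) ^ \<alpha> n)
          - ln (\<Sum>\<^sub>\<infinity>j\<in>{k+1..}. \<epsilon> j))
         / ln (inverse (lam * op_norm X nrm (translation (-1))) * \<mu>)) \<longrightarrow>
      (\<forall>k\<ge>1. nrm (\<lambda>x. f k x - (T ^^ \<alpha> k) \<phi> x) \<le> (\<Sum>\<^sub>\<infinity>n\<in>{k+1..}. \<epsilon> n)))"
proof -
  interpret banach_function_space X nrm by fact
  note solid = assms(3)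
  note T_def = assms(9) and S_def = assms(10)

  \<comment> \<open>Bounds and formulas for the powers of \<open>S\<close> and
    \<open>T\<close>\<close>
  define \<tau> where "\<tau> = op_norm X nrm (translation 1)"
  define M where "M = op_norm X nrm (translation (- 1))"
  define \<sigma> where "\<sigma> = op_norm X nrm S"
  have tr_im: "translation 1 ` X \<subseteq> X" "translation (- 1) ` X \<subseteq> X"
    using assms(4) by (auto simp: translation_invariant_def)
  have tr: "translation 1 g \<in> X" "translation (- 1) g \<in> X" if "g \<in> X" for g
    using tr_im that by auto
  have bd: "bounded_op X nrm (translation 1)" "bounded_op X nrm (translation (- 1))"
    using translation_bounded solid tr_im by auto
  have nonneg: "\<tau> \<ge> 0" "M \<ge> 0"
    unfolding \<tau>_def M_def using bd tr zero_closed by (auto intro: op_norm_nonneg)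
  have lam: "lam > 0" "lam > \<tau>" using nonneg assms(7) by (auto simp: \<tau>_def)
  have tr_le: "nrm (translation 1 g) \<le> \<tau> * nrm g" "nrm (translation (- 1) g) \<le> M * nrm g"
    if "g \<in> X" for g
    unfolding \<tau>_def M_def
    by (rule nrm_le_op_norm[OF bd(1) tr(1) _ that] nrm_le_op_norm[OF bd(2) tr(2) _ that];
        simp add: translation_def)+

  have S: "S g \<in> X" "nrm (S g) \<le> \<tau> / lam * nrm g" if "g \<in> X" for g
  proof -
    show "S g \<in> X" using tr(1)[OF that] by (simp add: S_def scale_closed del: of_real_inverse)
    have "nrm (S g) = inverse lam * nrm (translation 1 g)"
      using lam by (simp add: S_def nrm_scale tr that del: of_real_inverse)
    then show "nrm (S g) \<le> \<tau> / lam * nrm g"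
      using tr_le(1)[OF that] lam by (simp add: field_simps)
  qed
  have S_bd: "bounded_op X nrm S" unfolding bounded_op_def using S by blast
  have S_le: "nrm (S g) \<le> \<sigma> * nrm g" if "g \<in> X" for g
    unfolding \<sigma>_def
    by (rule nrm_le_op_norm; use S_bd S that in \<open>auto simp: S_def translation_def\<close>)
  \<comment> \<open>Here \<open>lam > \<tau>\<close> enters. With \<open>\<sigma> \<le> 1\<close>,
    powers of \<open>\<sigma>\<close> decrease as the exponent grows.\<close>
  have \<sigma>: "0 \<le> \<sigma>" "\<sigma> \<le> 1"
  proof -
    show "0 \<le> \<sigma>" unfolding \<sigma>_def using S_bd S zero_closed by (auto intro: op_norm_nonneg)
    have "nrm (S g) \<le> 1" if "g \<in> X" "nrm g \<le> 1" for g
    proof -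
      have "\<tau> / lam * nrm g \<le> 1 * 1"
        using that lam nonneg nrm_nonneg by (intro mult_mono) auto
      then show ?thesis using S(2)[OF that(1)] by simp
    qed
    then show "\<sigma> \<le> 1"
      unfolding \<sigma>_def op_norm_def
      by (intro cSUP_least) (use zero_closed nrm_zero in auto)
  qed
  have S_pow: "(S ^^ n) g \<in> X" "nrm ((S ^^ n) g) \<le> \<sigma> ^ n * nrm g" if "g \<in> X" for n g
    using funpow_bound[of S \<sigma> g n] S(1) S_le \<sigma> that by auto
  have S_pow_eq: "(S ^^ n) g x = of_real (inverse lam) ^ n * g (x - real n)" for n g x
    using scaled_translation_pow[where c = "of_real (inverse lam)" and a = 1] by (simp add: S_def)

  \<comment> \<open>\<open>P\<close> is \<open>T\<close> without its cutoff: solidity passes its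
    bound on to \<open>T\<close>, and its powers will carry the tails of the earlier terms.\<close>
  define P :: "(real \<Rightarrow> complex) \<Rightarrow> real \<Rightarrow> complex" where
    "P = (\<lambda>g x. of_real lam * translation (- 1) g x)"
  have P: "P g \<in> X" "nrm (P g) \<le> lam * M * nrm g" if "g \<in> X" for g
    using tr(2)[OF that] tr_le(2)[OF that] lam
    by (simp_all add: P_def scale_closed nrm_scale)
  have P_pow: "(P ^^ n) g \<in> X" "nrm ((P ^^ n) g) \<le> (lam * M) ^ n * nrm g" if "g \<in> X" for n g
    using funpow_bound[of P "lam * M" g n] P lam nonneg that by auto
  have P_pow_eq: "(P ^^ n) g x = of_real lam ^ n * g (x + real n)" for n g x
    using scaled_translation_pow[where c = "of_real lam" and a = "- 1"] by (simp add: P_def)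
  have cut: "(\<lambda>x. g x * indicator {c..} x) \<in> X \<and> nrm (\<lambda>x. g x * indicator {c..} x) \<le> nrm g"
    if "g \<in> X" for g c
  proof -
    have "(\<lambda>x. g x * indicator {c..} x) \<in> borel_measurable lebesgue"
      by (intro borel_measurable_times borel_measurable_indicator measurable[OF that]) auto
    moreover have "AE x in lebesgue. cmod (g x * indicator {c..} x) \<le> cmod (g x)"
      by (auto simp: indicator_def)
    ultimately show ?thesis by (rule solid_fsD[OF solid that])
  qed
  have T: "T g \<in> X" "nrm (T g) \<le> lam * M * nrm g" if "g \<in> X" for g
    using P[OF that] cut[of "P g" 0] by (auto simp: T_def P_def)
  have T_pow: "(T ^^ n) g \<in> X" "nrm ((T ^^ n) g) \<le> (lam * M) ^ n * nrm g" if "g \<in> X" for n g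
    using funpow_bound[of T "lam * M" g n] T lam nonneg that by auto
  have T_pow_eq: "(T ^^ n) g x =
      of_real lam ^ n * g (x + real n) * (if n = 0 then 1 else indicator {0..} x)" for n g x
    using truncated_translation_pow[where c = "of_real lam"] by (simp add: T_def)

  \<comment> \<open>Supports and sizes of the terms\<close>
  have f: "f k \<in> X" if "k \<ge> 1" for k using assms(11) that by blast
  have f_neg: "AE x in lebesgue. x + c < 0 \<longrightarrow> f k (x + c) = 0" if "k \<ge> 1" for k c
  proof (rule AE_lebesgue_shift)
    show "AE x in lebesgue. x < 0 \<longrightarrow> f k x = 0"
      using ess_supp_AE_zero[of "f k"]
      by (rule AE_mp) (use assms(11) that in \<open>force\<close>)
  qed
  have \<alpha>_mono: "\<alpha> j \<le> \<alpha> k" if "1 \<le> j" "j \<le> k" for j k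
    using monotone_onD[OF assms(16), of j k] that by auto
  have \<epsilon>_pos: "\<epsilon> k > 0" if "k \<ge> 1" for k using assms(14) that by blast
  have \<epsilon>_sum: "\<epsilon> summable_on {k..}" if "k \<ge> 1" for k
    using assms(15) by (rule summable_on_subset_banach) (use that in auto)
  \<comment> \<open>The hypothesis covers only consecutive indices; replacing \<open>j - 1\<close>
    by an earlier \<open>k\<close> enlarges the exponent and so keeps the bound.\<close>
  have head: "\<sigma> ^ (\<alpha> j - \<alpha> k) * nrm (f j) \<le> 1 / 2 * \<epsilon> j" if "1 \<le> k" "k < j" for j k
  proof -
    have "\<alpha> k \<le> \<alpha> (j - 1)" using that by (intro \<alpha>_mono) auto
    then have "\<sigma> ^ (\<alpha> j - \<alpha> k) * nrm (f j) \<le> \<sigma> ^ (\<alpha> j - \<alpha> (j - 1)) * nrm (f j)"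
      using that \<sigma> f
      by (intro mult_right_mono power_decreasing) (auto intro: nrm_nonneg)
    also have "\<dots> \<le> 1 / 2 * \<epsilon> j"
      using assms(17) that by (intro less_imp_le) (auto simp: \<sigma>_def)
    finally show ?thesis .
  qed
  let ?u = "\<lambda>k. (S ^^ \<alpha> k) (f k)"
  have u: "?u k \<in> X" if "k \<ge> 1" for k using S_pow f that by blast

  \<comment> \<open>Convergence of the series\<close>
  have "\<exists>\<phi>. sums_in X nrm ?u \<phi>"
  proof (rule sums_in_comparison[OF u])
    \<comment> \<open>\<open>summable\<close> starts at index 0, so the value
      \<open>\<epsilon> 0\<close> is adjoined; one term does not affect summability.\<close>
    have "\<epsilon> summable_on insert 0 {1..}"
      using assms(15) by (simp add: summable_on_insert_iff)
    moreover have "insert 0 {1..} = (UNIV :: nat set)" by auto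
    ultimately show "summable \<epsilon>" using summable_on_imp_summable by metis
    fix k :: nat assume k: "k \<ge> 2"
    have "nrm (?u k) \<le> \<sigma> ^ \<alpha> k * nrm (f k)" using S_pow f k by simp
    also have "\<dots> \<le> \<sigma> ^ (\<alpha> k - \<alpha> 1) * nrm (f k)"
      using \<sigma> f k by (intro mult_right_mono power_decreasing) (auto intro: nrm_nonneg)
    also have "\<dots> \<le> \<epsilon> k" using head[of 1 k] \<epsilon>_pos[of k] k by simp
    finally show "nrm (?u k) \<le> \<epsilon> k" .
  qed

  \<comment> \<open>The approximation error at index \<open>k\<close>\<close>
  moreover have "nrm (\<lambda>x. f k x - (T ^^ \<alpha> k) \<phi> x) \<le> (\<Sum>\<^sub>\<infinity>n\<in>{k+1..}. \<epsilon> n)"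
    if \<phi>: "sums_in X nrm ?u \<phi>"
      and gap: "\<forall>k\<ge>1. \<alpha> (k + 1) - \<alpha> k \<ge> a k"
      and large: "\<forall>k\<ge>2. real (\<alpha> k) \<ge>
         (ln 2 + ln (\<Sum>n=1..k-1. C n * (inverse (lam * M) * \<mu>) ^ \<alpha> n)
          - ln (\<Sum>\<^sub>\<infinity>j\<in>{k+1..}. \<epsilon> j)) / ln (inverse (lam * M) * \<mu>)"
      and k: "k \<ge> 1"
    for \<phi> k
  proof -
    define W where "W = (\<Sum>\<^sub>\<infinity>n\<in>{k+1..}. \<epsilon> n)"
    have \<phi>_X: "\<phi> \<in> X" and lim: "(\<lambda>n. nrm (\<lambda>x. (\<Sum>j=1..n. ?u j x) - \<phi> x)) \<longlonglongrightarrow> 0"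
      using \<phi> by (auto simp: sums_in_def)
    have W_ge: "sum \<epsilon> F \<le> W" if "finite F" "F \<subseteq> {k+1..}" for F
      unfolding W_def using that \<epsilon>_pos
      by (intro finite_sum_le_infsum \<epsilon>_sum) (auto intro: less_imp_le)
    \<comment> \<open>Needed for \<open>ln W\<close> to be a genuine logarithm, and it settles the
      cases in which the quantity bounded is 0.\<close>
    have "W > 0" using W_ge[of "{k+1}"] \<epsilon>_pos[of "k+1"] by simp
    show ?thesis
    proof (cases "M = 0")
      case True
      txt \<open>Only for \<open>X = {0}\<close>; the hypothesis \<open>large\<close> then carries no information, as it is about
        \<open>inverse 0\<close> and \<open>ln 0\<close>.\<close>
      have "nrm g = 0" if "g \<in> X" for g
      proof -
        have "nrm (translation (- 1) (translation 1 g)) \<le> 0"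
          using tr_le(2)[OF tr(1)[OF that]] True by simp
        then show ?thesis using nrm_nonneg[OF that] by (simp add: translation_def)
      qed
      then show ?thesis
        using diff_closed[OF f[OF k] T_pow(1)[OF \<phi>_X, of "\<alpha> k"]] \<open>W > 0\<close> by (simp add: W_def)
    next
      case False
      then have M: "M > 0" using nonneg by simp
      \<comment> \<open>Each unit of shift costs a factor \<open>lam * M\<close> in norm and gains
        \<open>\<mu>\<close> from the decay of the tail; \<open>r\<close> is the net gain.\<close>
      define r where "r = inverse (lam * M) * \<mu>"
      have lamM: "lam * M > 0" and \<mu>: "\<mu> > lam * M" "\<mu> > 0"
        using assms(8) less_trans[OF mult_pos_pos[OF lam(1) M]] M lam by (auto simp: M_def)
      have r: "r > 1" using lamM \<mu> by (simp add: r_def field_simps)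
      define v where "v j = (T ^^ \<alpha> k) (?u j)" for j
      have v: "v j \<in> X" if "j \<ge> 1" for j unfolding v_def using T_pow u that by blast
      \<comment> \<open>The net shift is a difference of reals, so one formula serves
        \<open>j < k\<close>, \<open>j = k\<close> and \<open>j > k\<close> without truncated
        subtraction.\<close>
      have v_eq: "v j x = of_real lam ^ \<alpha> k * (of_real (inverse lam) ^ \<alpha> j *
          f j (x + (real (\<alpha> k) - real (\<alpha> j)))) *
          (if \<alpha> k = 0 then 1 else indicator {0..} x)" for j x
        unfolding v_def T_pow_eq S_pow_eq by (simp add: algebra_simps)

      have below: "nrm (v j) \<le> C j * r ^ \<alpha> j / r ^ \<alpha> k" if j: "1 \<le> j" "j < k" for j
      proof -
        define d where "d = \<alpha> k - \<alpha> j"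
        have le: "\<alpha> j \<le> \<alpha> k" using \<alpha>_mono j by simp
        \<comment> \<open>The gap after \<open>j\<close> alone brings \<open>d\<close> up to
          \<open>a j\<close>, so the decay hypothesis applies at \<open>d\<close>.\<close>
        have "\<alpha> (j + 1) \<le> \<alpha> k" using j by (intro \<alpha>_mono) auto
        then have "a j \<le> d" using gap[rule_format, OF j(1)] by (simp add: d_def)
        let ?h = "\<lambda>x. f j x * indicator {real d..} x"
        have h: "?h \<in> X" "nrm ?h \<le> C j * \<mu> powr (- real d)"
          using cut f assms(13) j \<open>a j \<le> d\<close> by auto
        \<comment> \<open>After a shift by \<open>d\<close>, restriction to \<open>x \<ge> d\<close>
          becomes the cutoff at 0. If \<open>\<alpha> k = 0\<close> there is no cutoff, but then
          \<open>d = 0\<close> and \<open>f j\<close> vanishes on the negative axis.\<close>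
        have "AE x in lebesgue. v j x = (P ^^ d) ?h x"
          using f_neg[OF j(1), of "real d"]
        proof (rule AE_mp, intro AE_I2 impI)
          fix x assume x: "x + real d < 0 \<longrightarrow> f j (x + real d) = 0"
          have arg: "x + (real (\<alpha> k) - real (\<alpha> j)) = x + real d" using le by (simp add: d_def)
          have "of_real lam ^ \<alpha> k * of_real (inverse lam) ^ \<alpha> j = (of_real lam ^ d :: complex)"
            using le lam by (simp add: d_def power_diff field_simps)
          then have "v j x = of_real lam ^ d * f j (x + real d) *
              (if \<alpha> k = 0 then 1 else indicator {0..} x)"
            by (simp only: v_eq arg mult.assoc[symmetric])
          moreover have "\<alpha> k = 0 \<Longrightarrow> d = 0" by (simp add: d_def)
          ultimately show "v j x = (P ^^ d) ?h x"
            unfolding P_pow_eq using x by (auto simp: indicator_def)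
        qed
        then have "nrm (v j) = nrm ((P ^^ d) ?h)"
          using v j P_pow h by (intro nrm_ae_cong) auto
        also have "\<dots> \<le> (lam * M) ^ d * nrm ?h" using P_pow h by blast
        also have "\<dots> \<le> (lam * M) ^ d * (C j * \<mu> powr (- real d))"
          using h lamM by (intro mult_left_mono) auto
        also have "\<dots> = C j / r ^ d"
          using \<mu> lamM by (simp add: r_def powr_minus powr_realpow field_simps)
        \<comment> \<open>Separating \<open>\<alpha> j\<close> from \<open>\<alpha> k\<close>
          produces the summands inside the logarithm in \<open>large\<close>.\<close>
        also have "\<dots> = C j * r ^ \<alpha> j / r ^ \<alpha> k"
          using r le by (simp add: d_def power_diff)
        finally show ?thesis .
      qed

      have above: "nrm (v j) \<le> 1 / 2 * \<epsilon> j" if j: "k < j" for j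
      proof -
        define d where "d = \<alpha> j - \<alpha> k"
        have le: "\<alpha> k \<le> \<alpha> j" using \<alpha>_mono j k by simp
        \<comment> \<open>The cutoff is harmless: for \<open>x < 0\<close> also
          \<open>x - d < 0\<close>, where \<open>f j\<close> vanishes almost everywhere.\<close>
        have "AE x in lebesgue. v j x = (S ^^ d) (f j) x"
          using f_neg[OF order.trans[OF k less_imp_le[OF j]], of "- real d"]
        proof (rule AE_mp, intro AE_I2 impI)
          fix x assume x: "x + - real d < 0 \<longrightarrow> f j (x + - real d) = 0"
          have arg: "x + (real (\<alpha> k) - real (\<alpha> j)) = x - real d" using le by (simp add: d_def)
          have "of_real lam ^ \<alpha> k * of_real (inverse lam) ^ \<alpha> j =
              (of_real (inverse lam) ^ d :: complex)"
            using le lam by (simp add: d_def power_diff field_simps)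
          then have "v j x = of_real (inverse lam) ^ d * f j (x - real d) *
              (if \<alpha> k = 0 then 1 else indicator {0..} x)"
            by (simp only: v_eq arg mult.assoc[symmetric])
          then show "v j x = (S ^^ d) (f j) x"
            unfolding S_pow_eq using x by (auto simp: indicator_def)
        qed
        then have "nrm (v j) = nrm ((S ^^ d) (f j))"
          using v j k S_pow f by (intro nrm_ae_cong) auto
        also have "\<dots> \<le> \<sigma> ^ d * nrm (f j)" using S_pow f j k by simp
        also have "\<dots> \<le> 1 / 2 * \<epsilon> j" using head k j by (simp add: d_def)
        finally show ?thesis .
      qed

      have diag: "AE x in lebesgue. v k x = f k x"
        using f_neg[OF k, of 0]
        by (rule AE_mp) (use lam in \<open>auto simp: v_eq indicator_def field_simps\<close>)

      have sum_below: "(\<Sum>j=1..<k. nrm (v j)) \<le> 1 / 2 * W"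
      proof (cases "k = 1")
        case True
        then show ?thesis using \<open>W > 0\<close> by simp
      next
        case False
        then have k2: "k \<ge> 2" using k by simp
        define Q where "Q = (\<Sum>n=1..k-1. C n * r ^ \<alpha> n)"
        have "Q > 0"
          unfolding Q_def using k2 r assms(12) by (intro sum_pos) auto
        have "(ln 2 + ln Q - ln W) / ln r \<le> real (\<alpha> k)"
          using large k2 by (simp add: Q_def r_def W_def)
        \<comment> \<open>As \<open>ln r > 0\<close>, the denominator can be cleared; the logarithms
          then merge, and \<open>large\<close> becomes
          \<open>2 * Q / W \<le> r ^ \<alpha> k\<close>.\<close>
        then have "ln (2 * Q / W) \<le> ln (r ^ \<alpha> k)"
          using \<open>Q > 0\<close> \<open>W > 0\<close> r by (simp add: ln_mult ln_div ln_realpow field_simps)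
        then have "2 * Q / W \<le> r ^ \<alpha> k"
          using \<open>Q > 0\<close> \<open>W > 0\<close> r by (subst (asm) ln_le_cancel_iff) auto
        then have Q: "Q / r ^ \<alpha> k \<le> 1 / 2 * W"
          using \<open>W > 0\<close> r by (simp add: field_simps)
        have interval: "{1..<k} = {1..k-1}" using k2 by auto
        have "(\<Sum>j=1..<k. nrm (v j)) \<le> (\<Sum>j=1..<k. C j * r ^ \<alpha> j / r ^ \<alpha> k)"
          using below by (intro sum_mono) auto
        also have "\<dots> = Q / r ^ \<alpha> k" by (simp only: Q_def interval sum_divide_distrib)
        finally show ?thesis using Q by linarith
      qed

      \<comment> \<open>The power of \<open>T\<close> is applied to a partial sum, and its bound
        controls the remainder. The error is the image of the remainder minus all \<open>v j\<close>
        with \<open>j \<noteq> k\<close>; the remainder disappears as \<open>N\<close>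
        grows.\<close>
      have approx: "nrm (\<lambda>x. f k x - (T ^^ \<alpha> k) \<phi> x) \<le>
          W + (lam * M) ^ \<alpha> k * nrm (\<lambda>x. (\<Sum>j=1..N. ?u j x) - \<phi> x)" if N: "N \<ge> k" for N
      proof -
        let ?F = "{1..<k} \<union> {k+1..N}"
        let ?s = "\<lambda>x. (\<Sum>j=1..N. ?u j x) - \<phi> x"
        let ?g = "\<lambda>x. (T ^^ \<alpha> k) ?s x - (\<Sum>j\<in>?F. v j x)"
        have s: "?s \<in> X" using u \<phi>_X by (intro diff_closed sum_closed) auto
        have vs: "(\<lambda>x. \<Sum>j\<in>?F. v j x) \<in> X" using v by (intro sum_closed) auto
        have split: "(\<Sum>j=1..N. v j x) = v k x + (\<Sum>j\<in>?F. v j x)" for x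
        proof -
          have "{1..N} = insert k ?F" using k N by auto
          then show ?thesis by simp
        qed
        \<comment> \<open>Linearity is read off the closed formula for the powers of
          \<open>T\<close>.\<close>
        have T_s: "(T ^^ \<alpha> k) ?s x = (\<Sum>j=1..N. v j x) - (T ^^ \<alpha> k) \<phi> x" for x
          unfolding v_def T_pow_eq by (simp add: sum_distrib_left sum_distrib_right algebra_simps)
        have "AE x in lebesgue. f k x - (T ^^ \<alpha> k) \<phi> x = ?g x"
          using diag by (rule AE_mp) (intro AE_I2 impI, simp only: T_s split, simp)
        then have "nrm (\<lambda>x. f k x - (T ^^ \<alpha> k) \<phi> x) = nrm ?g"
          using T_pow s vs f k \<phi>_X by (intro nrm_ae_cong diff_closed) auto
        also have "\<dots> \<le> nrm ((T ^^ \<alpha> k) ?s) + nrm (\<lambda>x. \<Sum>j\<in>?F. v j x)"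
          using T_pow s vs by (intro nrm_triangle_diff) auto
        also have "nrm ((T ^^ \<alpha> k) ?s) \<le> (lam * M) ^ \<alpha> k * nrm ?s"
          using T_pow s by blast
        also have "nrm (\<lambda>x. \<Sum>j\<in>?F. v j x) \<le> (\<Sum>j\<in>?F. nrm (v j))"
          using v by (intro nrm_sum) auto
        also have "(\<Sum>j\<in>?F. nrm (v j)) = (\<Sum>j=1..<k. nrm (v j)) + (\<Sum>j=k+1..N. nrm (v j))"
          by (intro sum.union_disjoint) auto
        also have "(\<Sum>j=k+1..N. nrm (v j)) \<le> (\<Sum>j=k+1..N. 1 / 2 * \<epsilon> j)"
          using above by (intro sum_mono) auto
        also have "\<dots> \<le> 1 / 2 * W"
          using W_ge[of "{k+1..N}"] by (simp add: sum_divide_distrib[symmetric])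
        finally show ?thesis using sum_below by simp
      qed
      have "(\<lambda>N. W + (lam * M) ^ \<alpha> k * nrm (\<lambda>x. (\<Sum>j=1..N. ?u j x) - \<phi> x)) \<longlonglongrightarrow>
          W + (lam * M) ^ \<alpha> k * 0"
        by (intro tendsto_intros lim)
      then have "nrm (\<lambda>x. f k x - (T ^^ \<alpha> k) \<phi> x) \<le> W + (lam * M) ^ \<alpha> k * 0"
        by (rule LIMSEQ_le_const) (use approx in blast)
      then show ?thesis by (simp add: W_def)
    qed
  qed
  ultimately show ?thesis unfolding M_def by blast
qed

end
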